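(* Let $f:A\to B$ and $g:A\to C$ be ring homomorphisms, and let $J$ be an ideal of $B$ and $J'$ an ideal of $C$ such that $I:=f^{-1}(J)=g^{-1}(J')$. Consider the ring homomorphisms $$\alpha: f(A)+J\to A/I,\quad f(a)+j\mapsto \bar a,\qquad \beta: g(A)+J'\to A/I,\quad g(a)+j'\mapsto \bar a$$ ($a\in A$, $j\in J$, $j'\in J'$). Then the bi-amalgamation $A\bowtie^{f,g}(J,J')$ is the pullback of $\alpha$ and $\beta$, via the (surjective) coordinate projections $A\bowtie^{f,g}(J,J')\twoheadrightarrow f(A)+J$ and $A\bowtie^{f,g}(J,J')\twoheadrightarrow g(A)+J'$; that is, $$A\bowtie^{f,g}(J,J')=\alpha\times_{\frac{A}{I}}\beta .$$
   Context: All rings are commutative with unity, and ring homomorphisms are unital. The bi-amalgamation of $A$ with $(B,C)$ along $(J,J')$ with respect to $(f,g)$ is the subring of $B\times C$ $$A\bowtie^{f,g}(J,J'):=\{(f(a)+j,\,g(a)+j')\mid a\in A,\ (j,j')\in J\times J'\}.$$ Here $f(A)+J=\{f(a)+j\mid a\in A, j\in J\}$ is a subring of $B$ and $g(A)+J'$ is a subring of $C$ (defined analogously). For ring homomorphisms $\alpha:R_1\to D$ and $\beta:R_2\to D$, $\alpha\times_D\beta:=\{(x,y)\in R_1\times R_2\mid \alpha(x)=\beta(y)\}$. The bar denotes the class modulo $I$. *)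

theory Defs
  imports "HOL-Algebra.Algebra"
begin

definition bi_amalgamation ::
  "('a, 'm) ring_scheme \<Rightarrow> ('b, 'n) ring_scheme \<Rightarrow> ('c, 'k) ring_scheme \<Rightarrow>
   ('a \<Rightarrow> 'b) \<Rightarrow> ('a \<Rightarrow> 'c) \<Rightarrow> 'b set \<Rightarrow> 'c set \<Rightarrow> ('b \<times> 'c) ring" where
  "bi_amalgamation A B C f g J J' =
     (RDirProd B C)\<lparr>carrier :=
        {(f a \<oplus>\<^bsub>B\<^esub> j, g a \<oplus>\<^bsub>C\<^esub> j') | a j j'. a \<in> carrier A \<and> j \<in> J \<and> j' \<in> J'}\<rparr>"

definition image_plus_ideal ::
  "('a, 'm) ring_scheme \<Rightarrow> ('b, 'n) ring_scheme \<Rightarrow> ('a \<Rightarrow> 'b) \<Rightarrow> 'b set \<Rightarrow> ('b, 'n) ring_scheme" where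
  "image_plus_ideal A B f J = B\<lparr>carrier := (f ` carrier A) <+>\<^bsub>B\<^esub> J\<rparr>"

text \<open>The map sending \<open>f a + j\<close> to the class of \<open>a\<close> modulo \<open>I\<close>. The description is only
  meaningful on \<open>f(A) + J\<close> and when that class does not depend on the choice of \<open>a\<close> and \<open>j\<close>;
  this is not built into the definition and has to be established where the map is used.\<close>
definition residue_map ::
  "('a, 'm) ring_scheme \<Rightarrow> ('b, 'n) ring_scheme \<Rightarrow> ('a \<Rightarrow> 'b) \<Rightarrow> 'b set \<Rightarrow> 'a set \<Rightarrow> 'b \<Rightarrow> 'a set" where
  "residue_map A B f J I x =
     (THE K. \<exists>a\<in>carrier A. \<exists>j\<in>J. x = f a \<oplus>\<^bsub>B\<^esub> j \<and> K = I +>\<^bsub>A\<^esub> a)"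

definition fiber_product ::
  "('b, 'n) ring_scheme \<Rightarrow> ('c, 'k) ring_scheme \<Rightarrow> ('b \<Rightarrow> 'd) \<Rightarrow> ('c \<Rightarrow> 'd) \<Rightarrow> ('b \<times> 'c) ring" where
  "fiber_product R S \<alpha> \<beta> =
     (RDirProd R S)\<lparr>carrier := {(x, y). x \<in> carrier R \<and> y \<in> carrier S \<and> \<alpha> x = \<beta> y}\<rparr>"

end

theory Submission
  imports Defs
begin

text \<open>An equation \<open>f a + j = f a' + k\<close> forces \<open>f (a - a') \<in> J\<close>, that is \<open>a - a' \<in> I\<close>,
  so \<open>\<alpha>\<close> and likewise \<open>\<beta>\<close> are well defined. If \<open>\<alpha> (f a + j) = \<beta> (g b + k)\<close>, then \<open>b - a \<in> I\<close>,
  hence \<open>g b - g a \<in> J'\<close>, and the second component is \<open>g a + (g b - g a + k)\<close>, with the same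
  \<open>a\<close> as the first. Since \<open>J \<times> J'\<close> is an ideal of \<open>B \<times> C\<close>, the bi-amalgamation is itself
  of the form \<open>h(A) + K\<close>, for \<open>h = (f, g)\<close> and \<open>K = J \<times> J'\<close>; this makes it a subring.\<close>

section \<open>Ideals and homomorphisms into a product ring\<close>

lemma RDirProd_simps:
  "carrier (RDirProd R S) = carrier R \<times> carrier S"
  "monoid.mult (RDirProd R S) = (\<lambda>(x, y) (x', y'). (x \<otimes>\<^bsub>R\<^esub> x', y \<otimes>\<^bsub>S\<^esub> y'))"
  "monoid.one (RDirProd R S) = (\<one>\<^bsub>R\<^esub>, \<one>\<^bsub>S\<^esub>)"
  "ring.zero (RDirProd R S) = (\<zero>\<^bsub>R\<^esub>, \<zero>\<^bsub>S\<^esub>)"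
  "ring.add (RDirProd R S) = (\<lambda>(x, y) (x', y'). (x \<oplus>\<^bsub>R\<^esub> x', y \<oplus>\<^bsub>S\<^esub> y'))"
  by (simp_all add: RDirProd_def DirProd_def monoid.defs)

lemma ideal_Times:
  assumes "ideal J R" and "ideal K S"
  shows "ideal (J \<times> K) (RDirProd R S)"
proof -
  interpret J: ideal J R by fact
  interpret K: ideal K S by fact
  show ?thesis
  proof (rule idealI[OF RDirProd_ring[OF J.ring_axioms K.ring_axioms]])
    show "subgroup (J \<times> K) (add_monoid (RDirProd R S))"
      unfolding RDirProd_add_monoid
      by (rule DirProd_subgroups[OF J.a_group J.a_subgroup K.a_group K.a_subgroup])
  qed (auto simp: RDirProd_simps J.I_l_closed J.I_r_closed K.I_l_closed K.I_r_closed)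
qed

lemma ring_hom_Pair:
  assumes "f \<in> ring_hom A B" and "g \<in> ring_hom A C"
  shows "(\<lambda>a. (f a, g a)) \<in> ring_hom A (RDirProd B C)"
  using assms by (auto simp: ring_hom_def RDirProd_simps)

section \<open>The subring formed by a homomorphic image plus an ideal\<close>

lemma carrier_image_plus_ideal:
  "carrier (image_plus_ideal A B f J) = {f a \<oplus>\<^bsub>B\<^esub> j | a j. a \<in> carrier A \<and> j \<in> J}"
  by (auto simp: image_plus_ideal_def set_add_def')

lemma image_plus_ideal_simps:
  "monoid.mult (image_plus_ideal A B f J) = monoid.mult B"
  "monoid.one (image_plus_ideal A B f J) = monoid.one B"
  "ring.zero (image_plus_ideal A B f J) = ring.zero B"
  "ring.add (image_plus_ideal A B f J) = ring.add B"
  by (simp_all add: image_plus_ideal_def)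

lemma bi_amalgamation_eq_image_plus_ideal:
  "bi_amalgamation A B C f g J J' =
     image_plus_ideal A (RDirProd B C) (\<lambda>a. (f a, g a)) (J \<times> J')"
  unfolding bi_amalgamation_def image_plus_ideal_def set_add_def'
  \<comment> \<open>Both sides replace the carrier of the same record, so comparing the two carriers
    is enough.\<close>
  by (rule arg_cong[where f = "\<lambda>Z. (RDirProd B C)\<lparr>carrier := Z\<rparr>"])
    (auto simp: RDirProd_simps, blast)

context ring_hom_ring
begin

text \<open>Expanding the product, every term except \<open>h a\<close> times \<open>h b\<close> has
  a factor \<open>j\<close> or \<open>k\<close> and so lies in \<open>J\<close>. The remainder
  \<open>i\<close> is left anonymous: closure under products and multiplicativity of the residue map
  only need that it is in \<open>J\<close>.\<close>

lemma add_mult_eq: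
  assumes "ideal J S" and "a \<in> carrier R" and "b \<in> carrier R" and "j \<in> J" and "k \<in> J"
  obtains i where "i \<in> J" and "(h a \<oplus>\<^bsub>S\<^esub> j) \<otimes>\<^bsub>S\<^esub> (h b \<oplus>\<^bsub>S\<^esub> k) = h (a \<otimes> b) \<oplus>\<^bsub>S\<^esub> i"
proof -
  interpret J: ideal J S by fact
  have "j \<in> carrier S" and "k \<in> carrier S"
    using assms by auto
  then have "(h a \<oplus>\<^bsub>S\<^esub> j) \<otimes>\<^bsub>S\<^esub> (h b \<oplus>\<^bsub>S\<^esub> k) =
      h (a \<otimes> b) \<oplus>\<^bsub>S\<^esub> (h a \<otimes>\<^bsub>S\<^esub> k \<oplus>\<^bsub>S\<^esub> j \<otimes>\<^bsub>S\<^esub> (h b \<oplus>\<^bsub>S\<^esub> k))"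
    using assms by (simp add: S.l_distr S.r_distr S.a_ac)
  moreover have "h a \<otimes>\<^bsub>S\<^esub> k \<oplus>\<^bsub>S\<^esub> j \<otimes>\<^bsub>S\<^esub> (h b \<oplus>\<^bsub>S\<^esub> k) \<in> J"
    using assms by (simp add: J.I_l_closed J.I_r_closed)
  ultimately show ?thesis
    using that by blast
qed

lemma add_add_eq:
  assumes "ideal J S" and "a \<in> carrier R" and "b \<in> carrier R" and "j \<in> J" and "k \<in> J"
  shows "(h a \<oplus>\<^bsub>S\<^esub> j) \<oplus>\<^bsub>S\<^esub> (h b \<oplus>\<^bsub>S\<^esub> k) = h (a \<oplus> b) \<oplus>\<^bsub>S\<^esub> (j \<oplus>\<^bsub>S\<^esub> k)"
proof -
  interpret J: ideal J S by fact
  have "j \<in> carrier S" and "k \<in> carrier S"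
    using assms by auto
  then show ?thesis
    using assms by (simp add: S.a_ac)
qed

text \<open>Formulated for an arbitrary homomorphism so that it covers \<open>f\<close>,
  \<open>g\<close> and the pairing of the two.\<close>

lemma subring_image_plus_ideal:
  assumes "ideal J S"
  shows "subring (carrier (image_plus_ideal R S h J)) S"
proof -
  interpret J: ideal J S by fact
  let ?H = "{h a \<oplus>\<^bsub>S\<^esub> j | a j. a \<in> carrier R \<and> j \<in> J}"
  have mem: "h a \<oplus>\<^bsub>S\<^esub> j \<in> ?H" if "a \<in> carrier R" and "j \<in> J" for a j
    using that by blast
  have "subring ?H S"
  proof (rule S.subringI)
    show "?H \<subseteq> carrier S"
      by auto
    have "\<one>\<^bsub>S\<^esub> = h \<one> \<oplus>\<^bsub>S\<^esub> \<zero>\<^bsub>S\<^esub>"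
      by simp
    also have "\<dots> \<in> ?H"
      by (rule mem) simp_all
    finally show "\<one>\<^bsub>S\<^esub> \<in> ?H" .
  next
    fix x assume "x \<in> ?H"
    then obtain a j where aj: "a \<in> carrier R" "j \<in> J" "x = h a \<oplus>\<^bsub>S\<^esub> j"
      by blast
    then have "\<ominus>\<^bsub>S\<^esub> x = h (\<ominus> a) \<oplus>\<^bsub>S\<^esub> \<ominus>\<^bsub>S\<^esub> j"
      by (simp add: S.minus_add)
    also have "\<dots> \<in> ?H"
      using aj by (intro mem) simp_all
    finally show "\<ominus>\<^bsub>S\<^esub> x \<in> ?H" .
  next
    fix x y assume "x \<in> ?H" and "y \<in> ?H"
    then obtain a j b k where ab: "a \<in> carrier R" "b \<in> carrier R" and jk: "j \<in> J" "k \<in> J"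
      and x: "x = h a \<oplus>\<^bsub>S\<^esub> j" and y: "y = h b \<oplus>\<^bsub>S\<^esub> k"
      by blast
    obtain i where i: "i \<in> J" and "x \<otimes>\<^bsub>S\<^esub> y = h (a \<otimes> b) \<oplus>\<^bsub>S\<^esub> i"
      using add_mult_eq[OF assms ab jk] unfolding x y by blast
    note this(2)
    also have "h (a \<otimes> b) \<oplus>\<^bsub>S\<^esub> i \<in> ?H"
      using ab i by (intro mem) simp_all
    finally show "x \<otimes>\<^bsub>S\<^esub> y \<in> ?H" .
    have "x \<oplus>\<^bsub>S\<^esub> y = h (a \<oplus> b) \<oplus>\<^bsub>S\<^esub> (j \<oplus>\<^bsub>S\<^esub> k)"
      unfolding x y by (rule add_add_eq[OF assms ab jk])
    also have "\<dots> \<in> ?H"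
      using ab jk by (intro mem) simp_all
    finally show "x \<oplus>\<^bsub>S\<^esub> y \<in> ?H" .
  qed
  then show ?thesis
    by (simp only: carrier_image_plus_ideal)
qed

section \<open>The residue map to the quotient by the preimage ideal\<close>

lemma rcos_vimage_eq_iff:
  assumes "ideal J S" and "a \<in> carrier R" and "b \<in> carrier R"
  shows "{r \<in> carrier R. h r \<in> J} +> a = {r \<in> carrier R. h r \<in> J} +> b \<longleftrightarrow> h a \<ominus>\<^bsub>S\<^esub> h b \<in> J"
  \<comment> \<open>The cosets agree iff \<open>a\<close> minus \<open>b\<close> is in the preimage
    of \<open>J\<close>, and \<open>h\<close> carries this difference to \<open>h a\<close> minus
    \<open>h b\<close>.\<close>
  using R.quotient_eq_iff_same_a_r_cos[OF ideal_vimage[OF assms(1)] assms(2,3)] assms(2,3)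
  by (simp add: a_minus_def)

text \<open>This is well-definedness: the definite description has a unique value, since two
  representations of one element have first parts whose images differ by an element of
  \<open>J\<close>. From here on it serves as the computation rule for the residue map.\<close>

lemma residue_map_eq:
  assumes J: "ideal J S" and a: "a \<in> carrier R" and j: "j \<in> J"
    and I: "I = {r \<in> carrier R. h r \<in> J}"
  shows "residue_map R S h J I (h a \<oplus>\<^bsub>S\<^esub> j) = I +> a"
  unfolding residue_map_def
proof (rule the_equality)
  show "\<exists>b\<in>carrier R. \<exists>k\<in>J. h a \<oplus>\<^bsub>S\<^esub> j = h b \<oplus>\<^bsub>S\<^esub> k \<and> I +> a = I +> b"
    using a j by blast
next
  interpret J: ideal J S by (rule J)
  fix K assume "\<exists>b\<in>carrier R. \<exists>k\<in>J. h a \<oplus>\<^bsub>S\<^esub> j = h b \<oplus>\<^bsub>S\<^esub> k \<and> K = I +> b"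
  then obtain b k where b: "b \<in> carrier R" and k: "k \<in> J"
    and eq: "h a \<oplus>\<^bsub>S\<^esub> j = h b \<oplus>\<^bsub>S\<^esub> k" and K: "K = I +> b"
    by blast
  have carr: "h a \<in> carrier S" "h b \<in> carrier S" "j \<in> carrier S" "k \<in> carrier S"
    using a b j k by auto
  \<comment> \<open>Adding and subtracting \<open>k\<close> makes the second representation appear,
    so that \<open>eq\<close> can replace it by the first.\<close>
  have "h b \<ominus>\<^bsub>S\<^esub> h a = (h b \<oplus>\<^bsub>S\<^esub> k) \<ominus>\<^bsub>S\<^esub> k \<ominus>\<^bsub>S\<^esub> h a"
    using carr by (simp add: a_minus_def S.a_assoc S.r_neg)
  also have "\<dots> = (h a \<oplus>\<^bsub>S\<^esub> j) \<ominus>\<^bsub>S\<^esub> k \<ominus>\<^bsub>S\<^esub> h a"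
    by (simp only: eq)
  also have "\<dots> = (j \<ominus>\<^bsub>S\<^esub> k) \<oplus>\<^bsub>S\<^esub> (h a \<ominus>\<^bsub>S\<^esub> h a)"
    using carr by (simp add: a_minus_def S.a_ac)
  also have "\<dots> = j \<ominus>\<^bsub>S\<^esub> k"
    using carr by (simp add: a_minus_def S.r_neg)
  finally have "h b \<ominus>\<^bsub>S\<^esub> h a \<in> J"
    using j k by (simp add: a_minus_def)
  then show "K = I +> a"
    using rcos_vimage_eq_iff[OF J b a] K I by simp
qed

text \<open>On representatives the residue map is the quotient map, and sums and products of
  representatives are again in the form \<open>h c\<close> plus an element of \<open>J\<close>; the
  homomorphism laws are therefore inherited from the quotient map.\<close>

lemma residue_map_ring_hom:
  assumes J: "ideal J S" and I: "I = {r \<in> carrier R. h r \<in> J}"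
  shows "residue_map R S h J I \<in> ring_hom (image_plus_ideal R S h J) (R Quot I)"
proof -
  interpret J: ideal J S by (rule J)
  interpret I: ideal I R unfolding I by (rule ideal_vimage[OF J])
  interpret q: ring_hom_ring R "R Quot I" "(+>) I" by (rule I.rcos_ring_hom_ring)
  note res = residue_map_eq[OF J _ _ I]
  show ?thesis
  proof (rule ring_hom_memI)
    fix x assume "x \<in> carrier (image_plus_ideal R S h J)"
    then show "residue_map R S h J I x \<in> carrier (R Quot I)"
      by (auto simp: carrier_image_plus_ideal res)
  next
    fix x y
    assume "x \<in> carrier (image_plus_ideal R S h J)" and "y \<in> carrier (image_plus_ideal R S h J)"
    then obtain a j b k where ab: "a \<in> carrier R" "b \<in> carrier R" and jk: "j \<in> J" "k \<in> J"
      and x: "x = h a \<oplus>\<^bsub>S\<^esub> j" and y: "y = h b \<oplus>\<^bsub>S\<^esub> k"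
      unfolding carrier_image_plus_ideal by blast
    obtain i where "i \<in> J" "x \<otimes>\<^bsub>S\<^esub> y = h (a \<otimes> b) \<oplus>\<^bsub>S\<^esub> i"
      using add_mult_eq[OF J ab jk] unfolding x y by blast
    then show "residue_map R S h J I (x \<otimes>\<^bsub>image_plus_ideal R S h J\<^esub> y) =
        residue_map R S h J I x \<otimes>\<^bsub>R Quot I\<^esub> residue_map R S h J I y"
      \<comment> \<open>Without the deletions the simplifier would split
        \<open>h (a \<otimes> b)\<close>, and \<open>res\<close> would no longer match.\<close>
      using ab jk by (simp add: image_plus_ideal_simps res x y del: hom_mult hom_add)
    have "x \<oplus>\<^bsub>S\<^esub> y = h (a \<oplus> b) \<oplus>\<^bsub>S\<^esub> (j \<oplus>\<^bsub>S\<^esub> k)"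
      unfolding x y by (rule add_add_eq[OF J ab jk])
    then show "residue_map R S h J I (x \<oplus>\<^bsub>image_plus_ideal R S h J\<^esub> y) =
        residue_map R S h J I x \<oplus>\<^bsub>R Quot I\<^esub> residue_map R S h J I y"
      using ab jk by (simp add: image_plus_ideal_simps res x y del: hom_mult hom_add)
  next
    have "residue_map R S h J I (h \<one> \<oplus>\<^bsub>S\<^esub> \<zero>\<^bsub>S\<^esub>) = I +> \<one>"
      by (rule res) simp_all
    then show "residue_map R S h J I \<one>\<^bsub>image_plus_ideal R S h J\<^esub> = \<one>\<^bsub>R Quot I\<^esub>"
      by (simp add: image_plus_ideal_simps)
  qed
qed

end

section \<open>The coordinate projections and the pullback\<close>

lemma fst_image_bi_amalgamation:
  assumes "J' \<noteq> {}"
  shows "fst ` carrier (bi_amalgamation A B C f g J J') = carrier (image_plus_ideal A B f J)"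
  \<comment> \<open>Lifting \<open>f a\<close> plus \<open>j\<close> to a pair needs some second
    coordinate; \<open>g a\<close> plus any element of \<open>J'\<close> will do.\<close>
  using assms by (force simp: bi_amalgamation_def carrier_image_plus_ideal image_iff)

lemma snd_image_bi_amalgamation:
  assumes "J \<noteq> {}"
  shows "snd ` carrier (bi_amalgamation A B C f g J J') = carrier (image_plus_ideal A C g J')"
  using assms by (force simp: bi_amalgamation_def carrier_image_plus_ideal image_iff)

lemma fst_ring_hom_bi_amalgamation:
  "fst \<in> ring_hom (bi_amalgamation A B C f g J J') (image_plus_ideal A B f J)"
  by (rule ring_hom_memI)
    (auto simp: bi_amalgamation_def carrier_image_plus_ideal image_plus_ideal_simps RDirProd_simps,
      blast)

lemma snd_ring_hom_bi_amalgamation: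
  "snd \<in> ring_hom (bi_amalgamation A B C f g J J') (image_plus_ideal A C g J')"
  by (rule ring_hom_memI)
    (auto simp: bi_amalgamation_def carrier_image_plus_ideal image_plus_ideal_simps RDirProd_simps,
      blast)

lemma bi_amalgamation_eq_fiber_product:
  assumes "ring_hom_ring A B f" and "ring_hom_ring A C g"
    and J: "ideal J B" and J': "ideal J' C"
    and I: "I = {a \<in> carrier A. f a \<in> J}" and I': "I = {a \<in> carrier A. g a \<in> J'}"
  shows "bi_amalgamation A B C f g J J' =
    fiber_product (image_plus_ideal A B f J) (image_plus_ideal A C g J')
      (residue_map A B f J I) (residue_map A C g J' I)"
proof -
  interpret f: ring_hom_ring A B f by fact
  interpret g: ring_hom_ring A C g by fact
  interpret J': ideal J' C by fact
  note resf = f.residue_map_eq[OF J _ _ I] and resg = g.residue_map_eq[OF J' _ _ I']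
  let ?R = "image_plus_ideal A B f J" and ?S = "image_plus_ideal A C g J'"
  \<comment> \<open>The rings \<open>?R\<close> and \<open>?S\<close> inherit their operations from
    \<open>B\<close> and \<open>C\<close>, so the claimed equality of records reduces to one of
    carriers.\<close>
  have ops: "(RDirProd ?R ?S)\<lparr>carrier := Z\<rparr> = (RDirProd B C)\<lparr>carrier := Z\<rparr>" for Z
    by (rule ring.equality) (simp_all add: RDirProd_simps image_plus_ideal_simps)
  have "{(f a \<oplus>\<^bsub>B\<^esub> j, g a \<oplus>\<^bsub>C\<^esub> j') | a j j'. a \<in> carrier A \<and> j \<in> J \<and> j' \<in> J'} =
    {(x, y). x \<in> carrier ?R \<and> y \<in> carrier ?S \<and> residue_map A B f J I x = residue_map A C g J' I y}"
    (is "?P = ?F")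
  proof
    \<comment> \<open>Both coordinates use the same \<open>a\<close>, so both residues are its
      coset.\<close>
    show "?P \<subseteq> ?F"
      by (auto simp: carrier_image_plus_ideal resf resg)
    show "?F \<subseteq> ?P"
    proof clarify
      fix x y
      assume "x \<in> carrier ?R" and "y \<in> carrier ?S"
        and eq: "residue_map A B f J I x = residue_map A C g J' I y"
      then obtain a j b k where ab: "a \<in> carrier A" "b \<in> carrier A" and jk: "j \<in> J" "k \<in> J'"
        and x: "x = f a \<oplus>\<^bsub>B\<^esub> j" and y: "y = g b \<oplus>\<^bsub>C\<^esub> k"
        unfolding carrier_image_plus_ideal by blast
      have "I +>\<^bsub>A\<^esub> b = I +>\<^bsub>A\<^esub> a"
        using eq ab jk by (simp add: x y resf resg)
      then have "g b \<ominus>\<^bsub>C\<^esub> g a \<in> J'"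
        using g.rcos_vimage_eq_iff[OF J' ab(2,1)] by (simp add: I')
      then have "(g b \<ominus>\<^bsub>C\<^esub> g a) \<oplus>\<^bsub>C\<^esub> k \<in> J'"
        using jk by simp
      moreover have "y = g a \<oplus>\<^bsub>C\<^esub> ((g b \<ominus>\<^bsub>C\<^esub> g a) \<oplus>\<^bsub>C\<^esub> k)"
        using ab jk J'.a_subset
        \<comment> \<open>The fixed instance of \<open>a_lcomm\<close> moves \<open>g a\<close> past
          \<open>g b\<close> to its negative, where \<open>r_neg2\<close> cancels the two.\<close>
        by (simp add: y a_minus_def g.S.a_assoc g.S.a_lcomm[of "g a" "g b"] g.S.r_neg2 subsetD)
      ultimately show "\<exists>a j j'. (x, y) = (f a \<oplus>\<^bsub>B\<^esub> j, g a \<oplus>\<^bsub>C\<^esub> j') \<and>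
          a \<in> carrier A \<and> j \<in> J \<and> j' \<in> J'"
        using x ab jk by blast
    qed
  qed
  then show ?thesis
    by (simp add: bi_amalgamation_def fiber_product_def ops)
qed

text \<open>Because \<open>residue_map\<close> is a definite description, its values on all
  representatives are part of the conclusion: they certify that \<alpha> and \<beta> are the
  intended maps.\<close>

theorem proposition3p1:
  fixes A :: "('a, 'm) ring_scheme"
    and B :: "('b, 'n) ring_scheme"
    and C :: "('c, 'k) ring_scheme"
    and f :: "'a \<Rightarrow> 'b" and g :: "'a \<Rightarrow> 'c"
    and J :: "'b set" and J' :: "'c set" and I :: "'a set"
  assumes "cring A" and "cring B" and "cring C"
    and "f \<in> ring_hom A B" and "g \<in> ring_hom A C"
    and "ideal J B" and "ideal J' C"
    and "I = {a \<in> carrier A. f a \<in> J}" and "I = {a \<in> carrier A. g a \<in> J'}"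
  defines "R \<equiv> image_plus_ideal A B f J"
    and "S \<equiv> image_plus_ideal A C g J'"
    and "P \<equiv> bi_amalgamation A B C f g J J'"
    and "\<alpha> \<equiv> residue_map A B f J I"
    and "\<beta> \<equiv> residue_map A C g J' I"
  shows "ideal I A \<and>
         subring (carrier R) B \<and>
         subring (carrier S) C \<and>
         subring (carrier P) (RDirProd B C) \<and>
         \<alpha> \<in> ring_hom R (A Quot I) \<and>
         (\<forall>a\<in>carrier A. \<forall>j\<in>J. \<alpha> (f a \<oplus>\<^bsub>B\<^esub> j) = I +>\<^bsub>A\<^esub> a) \<and>
         \<beta> \<in> ring_hom S (A Quot I) \<and>
         (\<forall>a\<in>carrier A. \<forall>j'\<in>J'. \<beta> (g a \<oplus>\<^bsub>C\<^esub> j') = I +>\<^bsub>A\<^esub> a) \<and>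
         fst \<in> ring_hom P R \<and>
         fst ` carrier P = carrier R \<and>
         snd \<in> ring_hom P S \<and>
         snd ` carrier P = carrier S \<and>
         P = fiber_product R S \<alpha> \<beta>"
proof -
  interpret A: cring A by fact
  interpret B: cring B by fact
  interpret C: cring C by fact
  interpret f: ring_hom_ring A B f
    by (rule ring_hom_ringI2) (fact | rule A.ring_axioms B.ring_axioms)+
  interpret g: ring_hom_ring A C g
    by (rule ring_hom_ringI2) (fact | rule A.ring_axioms C.ring_axioms)+
  \<comment> \<open>With the pairing as homomorphism, the general subring lemma applies to the
    bi-amalgamation inside the product ring.\<close>
  interpret fg: ring_hom_ring A "RDirProd B C" "\<lambda>a. (f a, g a)"
    using assms(4,5)
    by (intro ring_hom_ringI2 RDirProd_ring ring_hom_Pair A.ring_axioms B.ring_axioms C.ring_axioms)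
  interpret J: ideal J B by fact
  interpret J': ideal J' C by fact
  have "ideal I A"
    unfolding assms(8) by (rule f.ideal_vimage) fact
  moreover have "subring (carrier R) B" and "subring (carrier S) C"
    unfolding R_def S_def
    by (rule f.subring_image_plus_ideal g.subring_image_plus_ideal, fact)+
  moreover have "subring (carrier P) (RDirProd B C)"
    unfolding P_def bi_amalgamation_eq_image_plus_ideal
    by (intro fg.subring_image_plus_ideal ideal_Times) fact+
  moreover have "\<alpha> \<in> ring_hom R (A Quot I)" and "\<beta> \<in> ring_hom S (A Quot I)"
    unfolding R_def S_def \<alpha>_def \<beta>_def
    using f.residue_map_ring_hom[OF assms(6,8)] g.residue_map_ring_hom[OF assms(7,9)] by auto
  moreover have "\<forall>a\<in>carrier A. \<forall>j\<in>J. \<alpha> (f a \<oplus>\<^bsub>B\<^esub> j) = I +>\<^bsub>A\<^esub> a"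
    using f.residue_map_eq[OF assms(6) _ _ assms(8)] by (simp add: \<alpha>_def)
  moreover have "\<forall>a\<in>carrier A. \<forall>j'\<in>J'. \<beta> (g a \<oplus>\<^bsub>C\<^esub> j') = I +>\<^bsub>A\<^esub> a"
    using g.residue_map_eq[OF assms(7) _ _ assms(9)] by (simp add: \<beta>_def)
  moreover have "fst ` carrier P = carrier R" and "snd ` carrier P = carrier S"
    unfolding P_def R_def S_def
    by (rule fst_image_bi_amalgamation snd_image_bi_amalgamation,
        use J.zero_closed J'.zero_closed in blast)+
  moreover have "fst \<in> ring_hom P R" and "snd \<in> ring_hom P S"
    unfolding P_def R_def S_def
    by (rule fst_ring_hom_bi_amalgamation snd_ring_hom_bi_amalgamation)+
  moreover have "P = fiber_product R S \<alpha> \<beta>"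
    unfolding P_def R_def S_def \<alpha>_def \<beta>_def
    by (rule bi_amalgamation_eq_fiber_product)
      (fact | rule f.ring_hom_ring_axioms g.ring_hom_ring_axioms)+
  ultimately show ?thesis
    by blast
qed

end
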